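(* Let $G$ be an undirected graph on vertex set $U=U_0\cup U_1$ (disjoint union) and let $H$ be a directed graph on vertex set $V=V_0\cup V_1$ (disjoint union), with adjacency matrices written in partitioned form $$G=\begin{pmatrix}G_{00}&G_{01}\\ G_{10}&G_{11}\end{pmatrix},\qquad H=\begin{pmatrix}H_{00}&H_{01}\\ H_{10}&H_{11}\end{pmatrix},$$ so that $G_{01}=G_{10}^T$. Let $l=\min(|U_0|,|U_1|)$ and let $(\sigma_1,\ldots,\sigma_l)$ be the singular values of the $|U_0|\times|U_1|$ matrix $G_{01}$. Then $$p(G\,\underline{\times}\,H)=\begin{cases}\left(\prod_{j=1}^l p(H\uparrow\sigma_j)\right)p(H_{00})^{|U_0|-|U_1|}, & \text{if } |U_0|\ge |U_1|;\\[4pt] \left(\prod_{j=1}^l p(H\uparrow\sigma_j)\right)p(H_{11})^{|U_1|-|U_0|}, & \text{if } |U_1|\ge |U_0|.\end{cases}$$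
   Context: Graphs are identified with their adjacency matrices (nonnegative integer entries; multiple arcs allowed; an undirected graph is one with symmetric adjacency matrix). For a directed graph $G$ on $U=U_0\cup U_1$, $G_{ij}$ is the $|U_i|\times|U_j|$ submatrix of arcs from $U_i$ to $U_j$; similarly $H_{ij}$ is the $|V_i|\times|V_j|$ submatrix of $H$ for arcs from $V_i$ to $V_j$. The partitioned tensor product is the matrix $$G\,\underline{\times}\,H=\begin{pmatrix} I_{|U_0|}\otimes H_{00} & G_{01}\otimes H_{01}\\ G_{10}\otimes H_{10} & I_{|U_1|}\otimes H_{11}\end{pmatrix},$$ where $\otimes$ is the Kronecker product and $I_k$ the $k\times k$ identity (equivalently: each vertex of $U_0$ is replaced by a copy of $H$ restricted to $V_0$, each vertex of $U_1$ by a copy of $H$ restricted to $V_1$, each arc of $G$ from $U_0$ to $U_1$ by a copy of the arcs of $H$ from $V_0$ to $V_1$, and each arc from $U_1$ to $U_0$ by a copy of the arcs from $V_1$ to $V_0$). For a complex number $\sigma$, $H\uparrow\sigma=\begin{pmatrix}H_{00}&\sigma H_{01}\\ \sigma H_{10}&H_{11}\end{pmatrix}$. For a square matrix $M$, $p(M)=\det(\lambda I-M)$ denotes its characteristic polynomial in $\lambda$ (with $p$ of a $0\times 0$ matrix equal to $1$). *)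

theory Defs
  imports
    Complex_Main
    "HOL-Library.Multiset"
    "Jordan_Normal_Form.Char_Poly"
begin

text \<open>
  A graph is its adjacency matrix, of type \<open>nat mat\<close> (entries are numbers of parallel arcs).  A vertex
  set \<open>U\<close> that is the disjoint union of \<open>U\<^sub>0\<close> and \<open>U\<^sub>1\<close> is \<open>{0..<u0 + u1}\<close>, where the first \<open>u0\<close>
  vertices form \<open>U\<^sub>0\<close>.  The partition of a graph is thus determined by the number \<open>u0\<close>, and
  \<open>split_block G u0 u0\<close> yields the submatrices \<open>(G\<^sub>0\<^sub>0, G\<^sub>0\<^sub>1, G\<^sub>1\<^sub>0, G\<^sub>1\<^sub>1)\<close>.  Either part may be empty.
\<close>

definition kronecker_prod :: "'a :: times mat \<Rightarrow> 'a mat \<Rightarrow> 'a mat" (infixl \<open>\<otimes>\<^sub>m\<close> 70) where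
  "A \<otimes>\<^sub>m B = mat (dim_row A * dim_row B) (dim_col A * dim_col B)
     (\<lambda>(i, j). A $$ (i div dim_row B, j div dim_col B) * B $$ (i mod dim_row B, j mod dim_col B))"

definition partitioned_tensor :: "nat \<Rightarrow> nat mat \<Rightarrow> nat \<Rightarrow> nat mat \<Rightarrow> nat mat" where
  "partitioned_tensor u0 G v0 H =
     (case (split_block G u0 u0, split_block H v0 v0) of
       ((G00, G01, G10, G11), (H00, H01, H10, H11)) \<Rightarrow>
         four_block_mat
           (1\<^sub>m (dim_row G00) \<otimes>\<^sub>m H00) (G01 \<otimes>\<^sub>m H01)
           (G10 \<otimes>\<^sub>m H10)               (1\<^sub>m (dim_row G11) \<otimes>\<^sub>m H11))"

definition scale_cross :: "nat \<Rightarrow> nat mat \<Rightarrow> complex \<Rightarrow> complex mat" where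
  "scale_cross v0 H \<sigma> =
     (case split_block (map_mat of_nat H) v0 v0 of
       (H00, H01, H10, H11) \<Rightarrow> four_block_mat H00 (\<sigma> \<cdot>\<^sub>m H01) (\<sigma> \<cdot>\<^sub>m H10) H11)"

definition graph_char_poly :: "nat mat \<Rightarrow> complex poly" where
  "graph_char_poly M = char_poly (map_mat of_nat M)"

text \<open>
  The multiset of singular values: the square roots of the eigenvalues, with multiplicity, of
  \<open>A A\<^sup>T\<close> or \<open>A\<^sup>T A\<close>, whichever is smaller.  That matrix is symmetric, so all its
  eigenvalues are real, and the multiset has \<open>min (dim_row A) (dim_col A)\<close> elements.
\<close>
definition singular_values :: "real mat \<Rightarrow> real multiset" where
  "singular_values A =
     image_mset sqrt (proots (char_poly
       (if dim_row A \<le> dim_col A then A * transpose_mat A else transpose_mat A * A)))"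

end

theory Submission
  imports Defs "Jordan_Normal_Form.Schur_Decomposition"
begin

text \<open>
  Write \<open>B = G\<^sub>0\<^sub>1\<close> with \<open>|U\<^sub>0| \<ge> |U\<^sub>1|\<close>, and fix \<open>\<lambda>\<close> that is not an eigenvalue of \<open>H\<^sub>0\<^sub>0\<close>, so that
  \<open>X = \<lambda>I - H\<^sub>0\<^sub>0\<close> is invertible.  With \<open>W = \<lambda>I - H\<^sub>1\<^sub>1\<close>, the Schur complement of \<open>I \<otimes> X\<close> in the
  characteristic matrix of the tensor product is \<open>I \<otimes> W - B\<^sup>TB \<otimes> H\<^sub>1\<^sub>0X\<^sup>-\<^sup>1H\<^sub>0\<^sub>1\<close>.  Triangularizing
  \<open>B\<^sup>TB\<close> turns its determinant into the product of \<open>det (W - \<sigma>\<^sup>2 H\<^sub>1\<^sub>0X\<^sup>-\<^sup>1H\<^sub>0\<^sub>1)\<close> over the singular values,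
  and \<open>det X\<close> times such a factor is again a Schur complement formula, now for the characteristic
  matrix of \<open>H\<close> with its off-diagonal blocks scaled by \<open>\<sigma>\<close>.  So no singular value decomposition of
  \<open>B\<close> is needed.  The two sides agree for all but finitely many \<open>\<lambda>\<close>, hence as polynomials; the
  other case follows by exchanging the two parts.
\<close>

section \<open>Algebra of the Kronecker product\<close>

lemma kronecker_dim [simp]:
  "dim_row (A \<otimes>\<^sub>m B) = dim_row A * dim_row B"
  "dim_col (A \<otimes>\<^sub>m B) = dim_col A * dim_col B"
  by (simp_all add: kronecker_prod_def)

lemma kronecker_carrier [intro, simp]:
  assumes "A \<in> carrier_mat m n" "B \<in> carrier_mat p q"
  shows "A \<otimes>\<^sub>m B \<in> carrier_mat (m * p) (n * q)"
  using assms[THEN carrier_matD(1)] assms[THEN carrier_matD(2)] by (intro carrier_matI) simp_all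

lemma kronecker_index [simp]:
  "i < dim_row A * dim_row B \<Longrightarrow> j < dim_col A * dim_col B \<Longrightarrow>
   (A \<otimes>\<^sub>m B) $$ (i, j) = A $$ (i div dim_row B, j div dim_col B) * B $$ (i mod dim_row B, j mod dim_col B)"
  by (simp add: kronecker_prod_def)

text \<open>The bound on \<open>i\<close> already forces \<open>p\<close> to be positive.\<close>

lemma mod_less_of_less_mult: "i < m * (p :: nat) \<Longrightarrow> i mod p < p"
  by (cases p) auto

lemmas div_mod_bounds = less_mult_imp_div_less mod_less_of_less_mult

lemma kronecker_one_one: "1\<^sub>m m \<otimes>\<^sub>m 1\<^sub>m n = (1\<^sub>m (m * n) :: 'a :: semiring_1 mat)"
proof (rule eq_matI)
  fix i j assume "i < dim_row (1\<^sub>m (m * n) :: 'a mat)" "j < dim_col (1\<^sub>m (m * n) :: 'a mat)"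
  moreover have "i div n = j div n \<and> i mod n = j mod n \<longleftrightarrow> i = j"
    by (metis div_mult_mod_eq)
  ultimately show "(1\<^sub>m m \<otimes>\<^sub>m 1\<^sub>m n) $$ (i, j) = (1\<^sub>m (m * n) :: 'a mat) $$ (i, j)"
    by (auto simp: div_mod_bounds)
qed auto

text \<open>An inner index \<open>k < n * q\<close> is the pair \<open>(k div q, k mod q)\<close>.
  Summing over such pairs gives a double sum whose terms separate into an
  \<open>A\<close>-\<open>C\<close> factor and a \<open>B\<close>-\<open>D\<close> factor.\<close>

lemma kronecker_mult:
  fixes A B C D :: "'a :: comm_semiring_0 mat"
  assumes "A \<in> carrier_mat m n" "B \<in> carrier_mat p q" "C \<in> carrier_mat n r" "D \<in> carrier_mat q s"
  shows "(A \<otimes>\<^sub>m B) * (C \<otimes>\<^sub>m D) = (A * C) \<otimes>\<^sub>m (B * D)"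
proof (rule eq_matI)
  fix i j assume "i < dim_row ((A * C) \<otimes>\<^sub>m (B * D))" "j < dim_col ((A * C) \<otimes>\<^sub>m (B * D))"
  then have i: "i < m * p" and j: "j < r * s" using assms by auto
  have "((A \<otimes>\<^sub>m B) * (C \<otimes>\<^sub>m D)) $$ (i, j) =
    (\<Sum>k<n * q. A $$ (i div p, k div q) * B $$ (i mod p, k mod q) *
               (C $$ (k div q, j div s) * D $$ (k mod q, j mod s)))"
    using i j assms by (auto simp: times_mat_def scalar_prod_def lessThan_atLeast0 intro!: sum.cong)
  \<comment> \<open>The range is cut into \<open>n\<close> consecutive intervals of length
    \<open>q\<close>, on each of which \<open>k div q\<close> is constant.\<close>
  also have "\<dots> = (\<Sum>a<n. \<Sum>k\<in>{a * q..<a * q + q}. A $$ (i div p, k div q) * B $$ (i mod p, k mod q) *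
               (C $$ (k div q, j div s) * D $$ (k mod q, j mod s)))"
    by (rule sum.nat_group[symmetric])
  also have "\<dots> = (\<Sum>a<n. \<Sum>b<q. A $$ (i div p, a) * B $$ (i mod p, b) *
               (C $$ (a, j div s) * D $$ (b, j mod s)))"
  proof (rule sum.cong[OF refl])
    fix a
    have div: "k div q = a" and mod: "k mod q = k - a * q" if "a * q \<le> k" "k < q + a * q" for k
      using that by (auto intro!: div_nat_eqI mod_nat_eqI simp: algebra_simps)
    show "(\<Sum>k\<in>{a * q..<a * q + q}. A $$ (i div p, k div q) * B $$ (i mod p, k mod q) *
               (C $$ (k div q, j div s) * D $$ (k mod q, j mod s))) =
      (\<Sum>b<q. A $$ (i div p, a) * B $$ (i mod p, b) * (C $$ (a, j div s) * D $$ (b, j mod s)))"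
      by (rule sum.reindex_bij_witness[where i = "\<lambda>b. a * q + b" and j = "\<lambda>k. k - a * q"])
        (auto simp: less_diff_conv2 add.commute div mod)
  qed
  also have "\<dots> = (\<Sum>a<n. A $$ (i div p, a) * C $$ (a, j div s)) * (\<Sum>b<q. B $$ (i mod p, b) * D $$ (b, j mod s))"
    by (simp add: sum_product mult_ac)
  also have "\<dots> = ((A * C) \<otimes>\<^sub>m (B * D)) $$ (i, j)"
    using i j assms div_mod_bounds[OF i] div_mod_bounds[OF j]
    by (auto simp: times_mat_def scalar_prod_def lessThan_atLeast0 intro!: arg_cong2[of _ _ _ _ "(*)"] sum.cong)
  finally show "((A \<otimes>\<^sub>m B) * (C \<otimes>\<^sub>m D)) $$ (i, j) = ((A * C) \<otimes>\<^sub>m (B * D)) $$ (i, j)" .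
qed (use assms in auto)

text \<open>The row and column indices of the left factor are the most significant part of an index
  of the product, so a partition of the left factor is inherited by contiguous blocks. A partition
  of the right factor would be interleaved instead.\<close>

lemma kronecker_four_block:
  fixes A B C D Y :: "'a :: times mat"
  assumes "A \<in> carrier_mat n1 m1" "B \<in> carrier_mat n1 m2" "C \<in> carrier_mat n2 m1" "D \<in> carrier_mat n2 m2"
    and "Y \<in> carrier_mat p q"
  shows "four_block_mat A B C D \<otimes>\<^sub>m Y =
    four_block_mat (A \<otimes>\<^sub>m Y) (B \<otimes>\<^sub>m Y) (C \<otimes>\<^sub>m Y) (D \<otimes>\<^sub>m Y)"
proof -
  have less: "i div r < n \<longleftrightarrow> i < n * r" if "i < l * r" for i r n l :: nat
  proof -
    have "0 < r" using that by (cases r) auto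
    then show ?thesis by (rule div_less_iff_less_mult)
  qed
  \<comment> \<open>Passing to a lower or right block removes \<open>n\<close> whole copies of the
    right factor, which shifts the quotient and keeps the remainder.\<close>
  have diff: "(i - n * r) div r = i div r - n" "(i - n * r) mod r = i mod r" if ge: "\<not> i < n * r" for i r n :: nat
  proof -
    obtain k where "i = n * r + k" using ge le_Suc_ex[of "n * r" i] by auto
    then show "(i - n * r) div r = i div r - n" "(i - n * r) mod r = i mod r" by (cases "r = 0"; simp)+
  qed
  have sub: "i - n * r < n' * r" if "\<not> i < n * r" "i < (n + n') * r" for i r n n' :: nat
    using that by (auto simp: algebra_simps)
  show ?thesis
  proof (rule eq_matI)
    fix i j
    assume "i < dim_row (four_block_mat (A \<otimes>\<^sub>m Y) (B \<otimes>\<^sub>m Y) (C \<otimes>\<^sub>m Y) (D \<otimes>\<^sub>m Y))"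
      "j < dim_col (four_block_mat (A \<otimes>\<^sub>m Y) (B \<otimes>\<^sub>m Y) (C \<otimes>\<^sub>m Y) (D \<otimes>\<^sub>m Y))"
    then have i: "i < (n1 + n2) * p" and j: "j < (m1 + m2) * q"
      using assms by (auto simp: distrib_right)
    show "(four_block_mat A B C D \<otimes>\<^sub>m Y) $$ (i, j) =
      four_block_mat (A \<otimes>\<^sub>m Y) (B \<otimes>\<^sub>m Y) (C \<otimes>\<^sub>m Y) (D \<otimes>\<^sub>m Y) $$ (i, j)"
    proof (cases "i < n1 * p"; cases "j < m1 * q")
      assume *: "i < n1 * p" "j < m1 * q"
      show ?thesis
        using i j assms div_mod_bounds[OF i] div_mod_bounds[OF j] * less[OF i] less[OF j]
        by (simp add: distrib_right)
    next
      assume *: "i < n1 * p" "\<not> j < m1 * q"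
      show ?thesis
        using i j assms div_mod_bounds[OF i] div_mod_bounds[OF j] * less[OF i] less[OF j]
          diff[OF *(2)] sub[OF *(2) j]
        by (simp add: distrib_right)
    next
      assume *: "\<not> i < n1 * p" "j < m1 * q"
      show ?thesis
        using i j assms div_mod_bounds[OF i] div_mod_bounds[OF j] * less[OF i] less[OF j]
          diff[OF *(1)] sub[OF *(1) i]
        by (simp add: distrib_right)
    next
      assume *: "\<not> i < n1 * p" "\<not> j < m1 * q"
      show ?thesis
        using i j assms div_mod_bounds[OF i] div_mod_bounds[OF j] * less[OF i] less[OF j]
          diff[OF *(1)] sub[OF *(1) i] diff[OF *(2)] sub[OF *(2) j]
        by (simp add: distrib_right)
    qed
  qed (use assms in \<open>auto simp: distrib_right\<close>)
qed

lemma kronecker_uminus_right: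
  "A \<otimes>\<^sub>m (- B) = - (A \<otimes>\<^sub>m (B :: 'a :: ring mat))"
  by (rule eq_matI) (auto simp: div_mod_bounds)

lemma kronecker_zero_left [simp]: "0\<^sub>m m n \<otimes>\<^sub>m B = 0\<^sub>m (m * dim_row B) (n * dim_col (B :: 'a :: mult_zero mat))"
  by (rule eq_matI) (auto simp: div_mod_bounds)

lemma kronecker_scalar_left:
  fixes A :: "'a :: comm_ring_1 mat"
  assumes "A \<in> carrier_mat 1 1" "Y \<in> carrier_mat p q"
  shows "A \<otimes>\<^sub>m Y = (A $$ (0, 0)) \<cdot>\<^sub>m Y"
  using assms by (intro eq_matI) auto

section \<open>Determinants of sums of two Kronecker products\<close>

text \<open>Splitting off the first row and column of \<open>T\<close> leaves a block upper
  triangular matrix. Its leading block is \<open>W + t \<cdot>\<^sub>m Y\<close> for the first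
  diagonal entry \<open>t\<close>, and its trailing block is the same expression for a smaller
  triangular matrix.\<close>

lemma det_kronecker_upper_triangular:
  fixes T :: "'a :: idom mat"
  assumes "T \<in> carrier_mat n n" "upper_triangular T" "W \<in> carrier_mat p p" "Y \<in> carrier_mat p p"
  shows "det (1\<^sub>m n \<otimes>\<^sub>m W + T \<otimes>\<^sub>m Y) = (\<Prod>t\<leftarrow>diag_mat T. det (W + t \<cdot>\<^sub>m Y))"
  using assms(1,2)
proof (induction n arbitrary: T)
  case 0
  then have "T = 0\<^sub>m 0 0" by auto
  then have "1\<^sub>m 0 \<otimes>\<^sub>m W + T \<otimes>\<^sub>m Y = 1\<^sub>m 0"
    by (intro eq_matI) auto
  then show ?case using \<open>T = _\<close> by (simp add: diag_mat_def)
next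
  case (Suc n)
  obtain A B C D where split: "split_block T 1 1 = (A, B, C, D)"
    by (cases "split_block T 1 1")
  have blocks: "A \<in> carrier_mat 1 1" "B \<in> carrier_mat 1 n" "C \<in> carrier_mat n 1" "D \<in> carrier_mat n n"
    "T = four_block_mat A B C D"
    using split_block[OF split, of n n] Suc.prems by auto
  have C: "C = 0\<^sub>m n 1"
    using split Suc.prems by (auto simp: split_block_def Let_def upper_triangular_def)
  have D: "upper_triangular D"
    using split Suc.prems by (auto simp: split_block_def Let_def upper_triangular_def)
  note YW = assms(3,4)
  have one: "1\<^sub>m (Suc n) = four_block_mat (1\<^sub>m 1) (0\<^sub>m 1 n) (0\<^sub>m n 1) (1\<^sub>m n :: 'a mat)"
    unfolding four_block_one_mat by simp
  have "1\<^sub>m (Suc n) \<otimes>\<^sub>m W + T \<otimes>\<^sub>m Y =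
      four_block_mat (1\<^sub>m 1 \<otimes>\<^sub>m W) (0\<^sub>m 1 n \<otimes>\<^sub>m W) (0\<^sub>m n 1 \<otimes>\<^sub>m W) (1\<^sub>m n \<otimes>\<^sub>m W)
      + four_block_mat (A \<otimes>\<^sub>m Y) (B \<otimes>\<^sub>m Y) (C \<otimes>\<^sub>m Y) (D \<otimes>\<^sub>m Y)"
    unfolding one blocks(5)
    by (intro arg_cong2[of _ _ _ _ "(+)"] kronecker_four_block) (use blocks YW in auto)
  also have "\<dots> = four_block_mat (W + A $$ (0, 0) \<cdot>\<^sub>m Y) (B \<otimes>\<^sub>m Y) (0\<^sub>m (n * p) p) (1\<^sub>m n \<otimes>\<^sub>m W + D \<otimes>\<^sub>m Y)"
    using blocks YW by (subst add_four_block_mat[of _ p p _ "n * p" _ "n * p"])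
      (auto simp: C kronecker_scalar_left[OF blocks(1) YW(2)] kronecker_scalar_left[OF one_carrier_mat YW(1)])
  also have "det \<dots> = det (W + A $$ (0, 0) \<cdot>\<^sub>m Y) * det (1\<^sub>m n \<otimes>\<^sub>m W + D \<otimes>\<^sub>m Y)"
    using blocks YW by (intro det_four_block_mat_lower_left_zero[of _ p _ "n * p"]) auto
  also have "det (1\<^sub>m n \<otimes>\<^sub>m W + D \<otimes>\<^sub>m Y) = (\<Prod>t\<leftarrow>diag_mat D. det (W + t \<cdot>\<^sub>m Y))"
    using blocks D by (intro Suc.IH)
  also have "diag_mat T = A $$ (0, 0) # diag_mat D"
    unfolding blocks(5) diag_four_block_mat[OF blocks(1,4)] using blocks(1) by (simp add: diag_mat_def)
  ultimately show ?case by simp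
qed

text \<open>Conjugation by \<open>P \<otimes>\<^sub>m 1\<^sub>m p\<close> fixes
  \<open>1\<^sub>m n \<otimes>\<^sub>m W\<close> and carries \<open>T \<otimes>\<^sub>m Y\<close> to
  \<open>S \<otimes>\<^sub>m Y\<close>.\<close>

lemma det_kronecker_similar:
  fixes S :: "'a :: idom mat"
  assumes S: "similar_mat_wit S T P Q" and [simp]: "S \<in> carrier_mat n n"
    and WY [simp]: "W \<in> carrier_mat p p" "Y \<in> carrier_mat p p"
  shows "det (1\<^sub>m n \<otimes>\<^sub>m W + S \<otimes>\<^sub>m Y) = det (1\<^sub>m n \<otimes>\<^sub>m W + T \<otimes>\<^sub>m Y)"
proof -
  note wit = similar_mat_witD2[OF \<open>S \<in> _\<close> S]
  note [simp] = wit(5-7) mult_carrier_mat[OF wit(6,5)]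
  let ?P = "P \<otimes>\<^sub>m 1\<^sub>m p" and ?Q = "Q \<otimes>\<^sub>m 1\<^sub>m p"
  have eq: "1\<^sub>m n \<otimes>\<^sub>m W + S \<otimes>\<^sub>m Y = ?P * (1\<^sub>m n \<otimes>\<^sub>m W + T \<otimes>\<^sub>m Y) * ?Q"
  proof -
    have PQ: "?P \<in> carrier_mat (n * p) (n * p)" "?Q \<in> carrier_mat (n * p) (n * p)" by auto
    have "?P * (1\<^sub>m n \<otimes>\<^sub>m W + T \<otimes>\<^sub>m Y) * ?Q = (?P * (1\<^sub>m n \<otimes>\<^sub>m W) + ?P * (T \<otimes>\<^sub>m Y)) * ?Q"
      by (subst mult_add_distrib_mat[OF PQ(1), of _ "n * p"]) auto
    also have "\<dots> = (P \<otimes>\<^sub>m W + (P * T) \<otimes>\<^sub>m Y) * ?Q"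
      by (simp add: kronecker_mult[of _ n n _ p p _ n _ p] wit right_mult_one_mat[OF wit(6)] left_mult_one_mat[OF WY(1)] left_mult_one_mat[OF WY(2)])
    also have "\<dots> = (P \<otimes>\<^sub>m W) * ?Q + ((P * T) \<otimes>\<^sub>m Y) * ?Q"
      by (rule add_mult_distrib_mat[OF _ _ PQ(2), of _ "n * p"]) (auto intro!: kronecker_carrier)
    also have "\<dots> = 1\<^sub>m n \<otimes>\<^sub>m W + S \<otimes>\<^sub>m Y"
      by (simp add: kronecker_mult[of _ n n _ p p _ n _ p] mult_carrier_mat[OF wit(6,5)] wit(1-4) right_mult_one_mat[OF WY(1)] right_mult_one_mat[OF WY(2)])
    finally show ?thesis ..
  qed
  have "det ?P * det ?Q = 1"
    by (simp add: det_mult[of _ "n * p", symmetric] kronecker_mult[of _ n n _ p p _ n _ p] wit kronecker_one_one)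
  moreover have "det (1\<^sub>m n \<otimes>\<^sub>m W + S \<otimes>\<^sub>m Y) = det ?P * det (1\<^sub>m n \<otimes>\<^sub>m W + T \<otimes>\<^sub>m Y) * det ?Q"
    unfolding eq
    by (subst det_mult[of _ "n * p"]; (subst det_mult[of _ "n * p"])?) (auto intro!: mult_carrier_mat[of _ _ "n * p"])
  ultimately show ?thesis
    by (metis mult.commute mult.left_commute mult_1)
qed

text \<open>By Schur decomposition, \<open>S\<close> is similar to an upper triangular matrix with
  diagonal \<open>es\<close>; hence the determinant depends on \<open>S\<close> through its
  eigenvalues alone.\<close>

lemma det_kronecker_char_poly:
  fixes S :: "complex mat"
  assumes S: "S \<in> carrier_mat n n" and es: "char_poly S = (\<Prod>e\<leftarrow>es. [:- e, 1:])"
    and WY: "W \<in> carrier_mat p p" "Y \<in> carrier_mat p p"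
  shows "det (1\<^sub>m n \<otimes>\<^sub>m W + S \<otimes>\<^sub>m Y) = (\<Prod>e\<leftarrow>es. det (W + e \<cdot>\<^sub>m Y))"
proof -
  obtain T P Q where d: "schur_decomposition S es = (T, P, Q)" by (metis prod_cases3)
  note schur = schur_decomposition[OF S es d]
  then have "T \<in> carrier_mat n n" using similar_mat_witD2[OF S] by blast
  then show ?thesis
    using det_kronecker_similar[of S T P Q n W p Y] det_kronecker_upper_triangular[of T n W p Y] schur S WY by simp
qed

section \<open>Determinants of two-by-two block matrices\<close>

text \<open>Multiplying by \<open>?J\<close> on the left swaps the block rows, and by
  \<open>?K\<close> on the right the block columns. These permutation matrices are inverse to each
  other, so their determinants cancel.\<close>

lemma det_four_block_swap:
  fixes A :: "'a :: comm_ring_1 mat"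
  assumes car: "A \<in> carrier_mat m m" "B \<in> carrier_mat m n" "C \<in> carrier_mat n m" "D \<in> carrier_mat n n"
  shows "det (four_block_mat A B C D) = det (four_block_mat D C B A)"
proof -
  let ?J = "four_block_mat (0\<^sub>m n m) (1\<^sub>m n) (1\<^sub>m m) (0\<^sub>m m n) :: 'a mat"
  let ?K = "four_block_mat (0\<^sub>m m n) (1\<^sub>m m) (1\<^sub>m n) (0\<^sub>m n m) :: 'a mat"
  let ?M = "four_block_mat A B C D"
  have J: "?J \<in> carrier_mat (m + n) (m + n)" and K: "?K \<in> carrier_mat (m + n) (m + n)"
    and M: "?M \<in> carrier_mat (m + n) (m + n)" using car by auto
  have "?J * ?M = four_block_mat C D A B"
    by (subst mult_four_block_mat[of _ n m _ n _ m _ _ m _ n]) (use car in auto)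
  also have "\<dots> * ?K = four_block_mat D C B A"
    by (subst mult_four_block_mat[of _ n m _ n _ m _ _ n _ m]) (use car in auto)
  finally have "det (four_block_mat D C B A) = det ?J * det ?M * det ?K"
    using det_mult[OF J M] det_mult[OF mult_carrier_mat[OF J M] K] by simp
  moreover have "?J * ?K = 1\<^sub>m (n + m)"
    by (subst mult_four_block_mat[of _ n m _ n _ m _ _ n _ m]) (use car in auto)
  then have "det ?J * det ?K = 1"
    using det_mult[OF J K] by simp
  ultimately show ?thesis by (metis mult.commute mult.left_commute mult_1)
qed

text \<open>The matrix factors as \<open>?L * ?R\<close>, block lower times block upper triangular.
  The complement is a sum with a negated term so that it fits the shape
  \<open>1\<^sub>m n \<otimes>\<^sub>m W + S \<otimes>\<^sub>m Y\<close>.\<close>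

lemma det_four_block_schur_complement:
  fixes A :: "'a :: idom mat"
  assumes car: "A \<in> carrier_mat m m" "B \<in> carrier_mat m n" "C \<in> carrier_mat n m" "D \<in> carrier_mat n n"
    and inv_car: "A' \<in> carrier_mat m m" and inv: "A * A' = 1\<^sub>m m"
  shows "det (four_block_mat A B C D) = det A * det (D + - (C * A' * B))"
proof -
  have prod_car: "C * A' * B \<in> carrier_mat n n" "A' * B \<in> carrier_mat m n"
    by (meson assms mult_carrier_mat)+
  let ?S = "D + - (C * A' * B)"
  let ?L = "four_block_mat A (0\<^sub>m m n) C (1\<^sub>m n)" and ?R = "four_block_mat (1\<^sub>m m) (A' * B) (0\<^sub>m n m) ?S"
  have "C * (A' * B) = C * A' * B" "A * (A' * B) = B"
    using assoc_mult_mat[OF car(3) inv_car car(2)] assoc_mult_mat[OF car(1) inv_car car(2)] inv car by simp_all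
  moreover have "C * A' * B + ?S = D"
    using prod_car car by (intro eq_matI) auto
  ultimately have "?L * ?R = four_block_mat A B C D"
    using car prod_car by (subst mult_four_block_mat[of _ m m _ n _ n _ _ m _ n]) auto
  moreover have "?L \<in> carrier_mat (m + n) (m + n)" "?R \<in> carrier_mat (m + n) (m + n)"
    using car prod_car by (intro four_block_carrier_mat; simp)+
  ultimately have "det (four_block_mat A B C D) = det ?L * det ?R"
    using det_mult by metis
  also have "\<dots> = det A * det (D + - (C * A' * B))"
    using car prod_car
    by (simp add: det_four_block_mat_upper_right_zero[of _ m _ n] det_four_block_mat_lower_left_zero[of _ m _ n])
  finally show ?thesis .
qed

section \<open>The characteristic determinant of the tensor product at one point\<close>

lemma kronecker_add_right:
  fixes A B C :: "'a :: semiring_0 mat"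
  assumes "B \<in> carrier_mat p q" "C \<in> carrier_mat p q"
  shows "A \<otimes>\<^sub>m (B + C) = A \<otimes>\<^sub>m B + A \<otimes>\<^sub>m C"
  using assms by (intro eq_matI) (auto simp: div_mod_bounds distrib_left)

lemma kronecker_smult_right:
  fixes A B :: "'a :: comm_semiring_0 mat"
  shows "A \<otimes>\<^sub>m (c \<cdot>\<^sub>m B) = c \<cdot>\<^sub>m (A \<otimes>\<^sub>m B)"
  by (rule eq_matI) (auto simp: div_mod_bounds mult_ac)

lemma map_mat_kronecker:
  fixes A B :: "nat mat"
  shows "map_mat of_nat (A \<otimes>\<^sub>m B) = map_mat of_nat A \<otimes>\<^sub>m (map_mat of_nat B :: 'a :: comm_semiring_1 mat)"
  by (rule eq_matI) (auto simp: div_mod_bounds)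

text \<open>This is the triangular formula for \<open>T = 0\<close>, whose diagonal consists of
  \<open>m\<close> zeros.\<close>

lemma det_one_kronecker:
  fixes X :: "'a :: idom mat"
  assumes X: "X \<in> carrier_mat p p"
  shows "det (1\<^sub>m m \<otimes>\<^sub>m X) = det X ^ m"
proof -
  have "1\<^sub>m m \<otimes>\<^sub>m X + 0\<^sub>m m m \<otimes>\<^sub>m X = 1\<^sub>m m \<otimes>\<^sub>m X" "X + 0 \<cdot>\<^sub>m X = X"
    using X by (auto intro!: eq_matI simp: div_mod_bounds)
  moreover have "diag_mat (0\<^sub>m m m) = replicate m (0 :: 'a)"
    by (intro nth_equalityI) (auto simp: diag_mat_def)
  ultimately show ?thesis
    using det_kronecker_upper_triangular[of "0\<^sub>m m m" m X p X] X by (simp add: upper_triangular_def)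
qed

text \<open>The inverse is the adjugate divided by the determinant.\<close>

lemma mat_right_inverse:
  fixes A :: "'a :: field mat"
  assumes A: "A \<in> carrier_mat n n" and det: "det A \<noteq> 0"
  obtains A' where "A' \<in> carrier_mat n n" "A * A' = 1\<^sub>m n"
proof
  let ?B = "inverse (det A) \<cdot>\<^sub>m adj_mat A"
  show "?B \<in> carrier_mat n n" using adj_mat(1)[OF A] by simp
  have "A * ?B = inverse (det A) \<cdot>\<^sub>m (A * adj_mat A)"
    by (rule mult_smult_distrib[OF A adj_mat(1)[OF A]])
  also have "\<dots> = 1\<^sub>m n"
    unfolding adj_mat(2)[OF A] using det by (intro eq_matI) auto
  finally show "A * ?B = 1\<^sub>m n" .
qed

lemma prod_list_mult_const:
  "(\<Prod>x\<leftarrow>xs. c * f x) = c ^ length xs * (\<Prod>x\<leftarrow>xs. f x :: 'a :: comm_monoid_mult)"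
  by (induction xs) (auto simp: mult_ac)

text \<open>The Schur complement of the first block leaves \<open>det X ^ m\<close> and one factor
  per singular value. Since \<open>n \<le> m\<close>, each of the \<open>n\<close> factors can
  absorb one \<open>det X\<close> to become the determinant for a scaled copy of \<open>H\<close>;
  the surplus is \<open>det X ^ (m - n)\<close>. The matrix \<open>B'\<close> stands for the
  transpose of \<open>B\<close> but enters through the spectrum of \<open>B' * B\<close>.\<close>

lemma det_partitioned_tensor:
  fixes B B' X P Q W :: "complex mat"
  assumes B: "B \<in> carrier_mat m n" "B' \<in> carrier_mat n m"
    and gram: "char_poly (B' * B) = (\<Prod>s\<leftarrow>\<sigma>. [:- s\<^sup>2, 1:])"
    and len: "length \<sigma> = n" "n \<le> m"
    and blocks: "X \<in> carrier_mat p p" "P \<in> carrier_mat p q" "Q \<in> carrier_mat q p" "W \<in> carrier_mat q q"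
    and X: "det X \<noteq> 0"
  shows "det (four_block_mat (1\<^sub>m m \<otimes>\<^sub>m X) (B \<otimes>\<^sub>m P) (B' \<otimes>\<^sub>m Q) (1\<^sub>m n \<otimes>\<^sub>m W)) =
    (\<Prod>s\<leftarrow>\<sigma>. det (four_block_mat X (s \<cdot>\<^sub>m P) (s \<cdot>\<^sub>m Q) W)) * det X ^ (m - n)"
proof -
  obtain X' where X': "X' \<in> carrier_mat p p" "X * X' = 1\<^sub>m p"
    by (rule mat_right_inverse[OF blocks(1) X])
  let ?Y = "- (Q * X' * P)"
  have car: "Q * X' \<in> carrier_mat q p" "Q * X' * P \<in> carrier_mat q q" "B' * B \<in> carrier_mat n n"
    using blocks X' B by auto
  have Y: "?Y \<in> carrier_mat q q" using car by simp
  have single: "det X * det (W + s\<^sup>2 \<cdot>\<^sub>m ?Y) = det (four_block_mat X (s \<cdot>\<^sub>m P) (s \<cdot>\<^sub>m Q) W)" for s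
  proof -
    \<comment> \<open>Both cross blocks carry a factor \<open>s\<close>, so the complement sees
      \<open>s\<^sup>2\<close>, an eigenvalue of \<open>B' * B\<close>.\<close>
    have "s \<cdot>\<^sub>m Q * X' * (s \<cdot>\<^sub>m P) = s\<^sup>2 \<cdot>\<^sub>m (Q * X' * P)"
      using mult_smult_assoc_mat[OF blocks(3) X'(1), of s]
        mult_smult_assoc_mat[OF car(1) smult_carrier_mat[OF blocks(2)], of s s]
        mult_smult_distrib[OF car(1) blocks(2), of s] car
      by (simp add: power2_eq_square) (intro eq_matI; simp)
    moreover have "- (s\<^sup>2 \<cdot>\<^sub>m (Q * X' * P)) = s\<^sup>2 \<cdot>\<^sub>m ?Y"
      by (intro eq_matI) auto
    ultimately show ?thesis
      using det_four_block_schur_complement[of X p "s \<cdot>\<^sub>m P" q "s \<cdot>\<^sub>m Q" W X'] blocks X' by simp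
  qed
  have "(B' \<otimes>\<^sub>m Q) * (1\<^sub>m m \<otimes>\<^sub>m X') * (B \<otimes>\<^sub>m P) = (B' * B) \<otimes>\<^sub>m (Q * X' * P)"
    using kronecker_mult[OF B(2) blocks(3) one_carrier_mat X'(1)] kronecker_mult[OF B(2) car(1) B(1) blocks(2)] B
    by simp
  then have "det (four_block_mat (1\<^sub>m m \<otimes>\<^sub>m X) (B \<otimes>\<^sub>m P) (B' \<otimes>\<^sub>m Q) (1\<^sub>m n \<otimes>\<^sub>m W)) =
      det (1\<^sub>m m \<otimes>\<^sub>m X) * det (1\<^sub>m n \<otimes>\<^sub>m W + (B' * B) \<otimes>\<^sub>m ?Y)"
    using det_four_block_schur_complement[OF kronecker_carrier[OF one_carrier_mat[of m] blocks(1)]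
        kronecker_carrier[OF B(1) blocks(2)] kronecker_carrier[OF B(2) blocks(3)]
        kronecker_carrier[OF one_carrier_mat[of n] blocks(4)] kronecker_carrier[OF one_carrier_mat[of m] X'(1)]]
      kronecker_mult[OF one_carrier_mat[of m] blocks(1) one_carrier_mat X'(1)] X'(2)
    by (simp add: kronecker_one_one kronecker_uminus_right)
  also have "det (1\<^sub>m n \<otimes>\<^sub>m W + (B' * B) \<otimes>\<^sub>m ?Y) = (\<Prod>s\<leftarrow>\<sigma>. det (W + s\<^sup>2 \<cdot>\<^sub>m ?Y))"
    using det_kronecker_char_poly[OF car(3), of "map (\<lambda>s. s\<^sup>2) \<sigma>" W q ?Y] gram blocks(4) Y
    by (simp add: o_def)
  also have "det (1\<^sub>m m \<otimes>\<^sub>m X) = det X ^ length \<sigma> * det X ^ (m - n)"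
    using det_one_kronecker[OF blocks(1)] len by (simp flip: power_add)
  finally show ?thesis
    unfolding single[symmetric] prod_list_mult_const by simp
qed

section \<open>From values to characteristic polynomials\<close>

text \<open>Evaluation at a point commutes with the determinant.\<close>

lemma poly_char_poly:
  fixes A :: "'a :: comm_ring_1 mat"
  assumes "A \<in> carrier_mat n n"
  shows "poly (char_poly A) x = det (x \<cdot>\<^sub>m 1\<^sub>m n + - A)"
  unfolding char_poly_def
  by (rule poly_det_cong[of _ n]) (use assms in \<open>auto simp: char_poly_matrix_def\<close>)

lemma char_matrix_four_block:
  fixes A B C D :: "'a :: comm_ring_1 mat"
  assumes "A \<in> carrier_mat m m" "B \<in> carrier_mat m n" "C \<in> carrier_mat n m" "D \<in> carrier_mat n n"
  shows "x \<cdot>\<^sub>m 1\<^sub>m (m + n) + - four_block_mat A B C D =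
    four_block_mat (x \<cdot>\<^sub>m 1\<^sub>m m + - A) (- B) (- C) (x \<cdot>\<^sub>m 1\<^sub>m n + - D)"
  using assms by (intro eq_matI) auto

lemma char_poly_four_block_swap:
  fixes A B C D :: "complex mat"
  assumes car: "A \<in> carrier_mat m m" "B \<in> carrier_mat m n" "C \<in> carrier_mat n m" "D \<in> carrier_mat n n"
  shows "char_poly (four_block_mat A B C D) = char_poly (four_block_mat D C B A)"
proof -
  have "poly (char_poly (four_block_mat A B C D)) x = poly (char_poly (four_block_mat D C B A)) x" for x
    using det_four_block_swap[of "x \<cdot>\<^sub>m 1\<^sub>m m + - A" m "- B" n "- C" "x \<cdot>\<^sub>m 1\<^sub>m n + - D"] car
    by (simp add: poly_char_poly[OF four_block_carrier_mat[OF car(1,4)]]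
      poly_char_poly[OF four_block_carrier_mat[OF car(4,1)]] char_matrix_four_block[of _ m _ n]
      char_matrix_four_block[of _ n _ m])
  then show ?thesis by (simp add: poly_eq_poly_eq_iff[symmetric] fun_eq_iff)
qed

text \<open>The product \<open>d * (p - q)\<close> vanishes everywhere: at the roots of
  \<open>d\<close> because of \<open>d\<close>, elsewhere by assumption. In characteristic zero it
  is therefore the zero polynomial, and \<open>d\<close> cancels.\<close>

lemma poly_eqI_off_roots:
  fixes d p q :: "'a :: {idom, ring_char_0} poly"
  assumes d: "d \<noteq> 0" and eq: "\<And>x. poly d x \<noteq> 0 \<Longrightarrow> poly p x = poly q x"
  shows "p = q"
proof -
  have "\<forall>x. poly (d * (p - q)) x = 0"
    using eq by auto
  then have "d * (p - q) = 0"
    unfolding poly_all_0_iff_0 .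
  then show ?thesis using d by simp
qed

text \<open>Away from the roots of \<open>char_poly H00\<close> the matrix
  \<open>x \<cdot>\<^sub>m 1\<^sub>m p + - H00\<close> is invertible and the pointwise determinant
  formula applies; the exceptional points are removed by taking
  \<open>d = char_poly H00\<close>.\<close>

lemma char_poly_partitioned_tensor:
  fixes B B' H00 H01 H10 H11 :: "complex mat"
  assumes B: "B \<in> carrier_mat m n" "B' \<in> carrier_mat n m"
    and gram: "char_poly (B' * B) = (\<Prod>s\<leftarrow>\<sigma>. [:- s\<^sup>2, 1:])"
    and len: "length \<sigma> = n" "n \<le> m"
    and H: "H00 \<in> carrier_mat p p" "H01 \<in> carrier_mat p q" "H10 \<in> carrier_mat q p" "H11 \<in> carrier_mat q q"
  shows "char_poly (four_block_mat (1\<^sub>m m \<otimes>\<^sub>m H00) (B \<otimes>\<^sub>m H01) (B' \<otimes>\<^sub>m H10) (1\<^sub>m n \<otimes>\<^sub>m H11)) =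
    (\<Prod>s\<leftarrow>\<sigma>. char_poly (four_block_mat H00 (s \<cdot>\<^sub>m H01) (s \<cdot>\<^sub>m H10) H11)) * char_poly H00 ^ (m - n)"
    (is "?L = ?R")
proof -
  have diag: "x \<cdot>\<^sub>m 1\<^sub>m (k * r) + - (1\<^sub>m k \<otimes>\<^sub>m M) = 1\<^sub>m k \<otimes>\<^sub>m (x \<cdot>\<^sub>m 1\<^sub>m r + - M)"
    if "M \<in> carrier_mat r r" for x k r and M :: "complex mat"
    using that by (subst kronecker_add_right[of _ r r])
      (auto simp: kronecker_smult_right kronecker_uminus_right kronecker_one_one)
  have eq: "poly ?L x = poly ?R x" if "poly (char_poly H00) x \<noteq> 0" for x
  proof -
    let ?c = "\<lambda>n M. x \<cdot>\<^sub>m 1\<^sub>m n + - (M :: complex mat)"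
    have "poly ?L x = det (?c (m * p + n * q)
        (four_block_mat (1\<^sub>m m \<otimes>\<^sub>m H00) (B \<otimes>\<^sub>m H01) (B' \<otimes>\<^sub>m H10) (1\<^sub>m n \<otimes>\<^sub>m H11)))"
      by (intro poly_char_poly four_block_carrier_mat kronecker_carrier one_carrier_mat H)
    also have "?c (m * p + n * q)
        (four_block_mat (1\<^sub>m m \<otimes>\<^sub>m H00) (B \<otimes>\<^sub>m H01) (B' \<otimes>\<^sub>m H10) (1\<^sub>m n \<otimes>\<^sub>m H11)) =
      four_block_mat (1\<^sub>m m \<otimes>\<^sub>m ?c p H00) (B \<otimes>\<^sub>m - H01) (B' \<otimes>\<^sub>m - H10) (1\<^sub>m n \<otimes>\<^sub>m ?c q H11)"
      unfolding diag[OF H(1), symmetric] diag[OF H(4), symmetric] kronecker_uminus_right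
      by (intro char_matrix_four_block kronecker_carrier one_carrier_mat H B)
    also have "det \<dots> = (\<Prod>s\<leftarrow>\<sigma>. det (four_block_mat (?c p H00) (s \<cdot>\<^sub>m - H01) (s \<cdot>\<^sub>m - H10) (?c q H11)))
        * det (?c p H00) ^ (m - n)"
      using that H poly_char_poly[OF H(1)]
      by (intro det_partitioned_tensor[OF B gram len, of _ p _ q]) auto
    also have "(\<lambda>s. det (four_block_mat (?c p H00) (s \<cdot>\<^sub>m - H01) (s \<cdot>\<^sub>m - H10) (?c q H11))) =
        (\<lambda>s. poly (char_poly (four_block_mat H00 (s \<cdot>\<^sub>m H01) (s \<cdot>\<^sub>m H10) H11)) x)"
    proof
      fix s
      have "s \<cdot>\<^sub>m - M = - (s \<cdot>\<^sub>m M)" for M :: "complex mat"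
        by (intro eq_matI) auto
      then show "det (four_block_mat (?c p H00) (s \<cdot>\<^sub>m - H01) (s \<cdot>\<^sub>m - H10) (?c q H11)) =
          poly (char_poly (four_block_mat H00 (s \<cdot>\<^sub>m H01) (s \<cdot>\<^sub>m H10) H11)) x"
        using H by (simp add: poly_char_poly[OF four_block_carrier_mat[OF H(1,4)]] char_matrix_four_block[of _ p _ q])
    qed
    finally show ?thesis
      using poly_char_poly[OF H(1)] by (simp add: poly_prod_list o_def)
  qed
  \<comment> \<open>A characteristic polynomial is monic.\<close>
  have "char_poly H00 \<noteq> 0"
    using degree_monic_char_poly[OF H(1)] by auto
  then show ?thesis
    by (rule poly_eqI_off_roots) (rule eq)
qed

section \<open>Spectrum of the Gram matrix and singular values\<close>

text \<open>For an eigenvector \<open>v\<close>, the Hermitian product gives \<open>a * (v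
  \<bullet>c v) = (?C *\<^sub>v v) \<bullet>c (?C *\<^sub>v v)\<close>, where the left factor of
  \<open>a\<close> is positive and the right side is nonnegative. The eigenvalue is taken as complex
  because it will come from a factorization over the complex numbers.\<close>

lemma gram_eigenvalue_nonneg:
  fixes A :: "real mat" and a :: complex
  assumes A: "A \<in> carrier_mat m n"
    and ev: "eigenvalue (map_mat of_real (transpose_mat A * A)) a"
  shows "a = of_real (Re a)" "0 \<le> Re a"
proof -
  let ?C = "map_mat complex_of_real A"
  have C: "?C \<in> carrier_mat m n" "transpose_mat ?C \<in> carrier_mat n m" using A by auto
  have S: "map_mat complex_of_real (transpose_mat A * A) = transpose_mat ?C * ?C"
    using of_real_hom.mat_hom_mult[of "transpose_mat A" n m A n] A by (simp add: map_mat_transpose)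
  obtain v where v: "v \<in> carrier_vec n" "v \<noteq> 0\<^sub>v n" "transpose_mat ?C * ?C *\<^sub>v v = a \<cdot>\<^sub>v v"
    using ev A unfolding eigenvalue_def eigenvector_def S by auto
  \<comment> \<open>Conjugation passes through \<open>?C\<close> because its entries are
    real.\<close>
  have conj: "conjugate (?C *\<^sub>v v) = ?C *\<^sub>v conjugate v"
    using A v by (intro eq_vecI) (auto simp: scalar_prod_def)
  have Cv: "?C *\<^sub>v v \<in> carrier_vec m" using C v by auto
  have "a * (v \<bullet>c v) = (a \<cdot>\<^sub>v v) \<bullet>c v"
    using v by simp
  also have "a \<cdot>\<^sub>v v = transpose_mat ?C *\<^sub>v (?C *\<^sub>v v)"
    using v C by (simp add: assoc_mult_mat_vec[of _ n m _ n])
  also have "(transpose_mat ?C *\<^sub>v (?C *\<^sub>v v)) \<bullet>c v = (?C *\<^sub>v v) \<bullet> (?C *\<^sub>v conjugate v)"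
    using v C Cv transpose_vec_mult_scalar[OF C(1), of "conjugate v" "?C *\<^sub>v v"] by simp
  also have "\<dots> = (?C *\<^sub>v v) \<bullet>c (?C *\<^sub>v v)" by (simp add: conj)
  finally have eq: "a * (v \<bullet>c v) = (?C *\<^sub>v v) \<bullet>c (?C *\<^sub>v v)" .
  have "0 < v \<bullet>c v" using v by simp
  then have v_pos: "Im (v \<bullet>c v) = 0" "0 < Re (v \<bullet>c v)" by (auto simp: less_complex_def)
  have "0 \<le> (?C *\<^sub>v v) \<bullet>c (?C *\<^sub>v v)" by (rule conjugate_square_ge_0_vec)
  then have "0 \<le> Re a * Re (v \<bullet>c v)" "Im a * Re (v \<bullet>c v) = 0"
    using v_pos by (auto simp: less_eq_complex_def simp flip: eq)
  then show "a = of_real (Re a)" "0 \<le> Re a"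
    using v_pos by (auto simp: complex_eq_iff zero_le_mult_iff)
qed

text \<open>Singular values are defined from real roots, whereas the determinant formula needs a
  complete complex factorization. The complex eigenvalues are real and nonnegative, so the
  polynomial already splits over the reals, and squaring undoes \<open>sqrt\<close>.\<close>

lemma gram_char_poly:
  fixes A :: "real mat"
  assumes A: "A \<in> carrier_mat m n"
    and \<sigma>: "mset \<sigma> = image_mset sqrt (proots (char_poly (transpose_mat A * A)))"
  shows "length \<sigma> = n"
    and "char_poly (map_mat complex_of_real (transpose_mat A * A)) = (\<Prod>s\<leftarrow>map of_real \<sigma>. [:- s\<^sup>2, 1:])"
proof -
  let ?S = "transpose_mat A * A" and ?C = "map_mat complex_of_real :: real mat \<Rightarrow> _"
  have S: "?S \<in> carrier_mat n n" and CS: "?C ?S \<in> carrier_mat n n" using A by auto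
  obtain as where as: "char_poly (?C ?S) = (\<Prod>a\<leftarrow>as. [:- a, 1:])" "length as = n"
    using char_poly_factorized[OF CS] by auto
  have ev: "eigenvalue (?C ?S) a" if "a \<in> set as" for a
    using that unfolding eigenvalue_root_char_poly[OF CS] as
    by (induction as) (auto simp: poly_prod_list)
  define rs where "rs = map Re as"
  have nonneg: "0 \<le> r" if "r \<in> set rs" for r
    using that gram_eigenvalue_nonneg(2)[OF A ev] by (auto simp: rs_def)
  have as_rs: "as = map of_real rs"
    using gram_eigenvalue_nonneg(1)[OF A ev] by (auto simp: rs_def o_def intro!: map_idI[symmetric])
  interpret h: map_poly_comm_ring_hom complex_of_real ..
  have "map_poly complex_of_real (\<Prod>r\<leftarrow>rs. [:- r, 1:]) = (\<Prod>a\<leftarrow>as. [:- a, 1:])"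
    unfolding as_rs by (simp add: h.hom_prod_list o_def map_poly_pCons)
  then have "map_poly complex_of_real (char_poly ?S) = map_poly complex_of_real (\<Prod>r\<leftarrow>rs. [:- r, 1:])"
    using trans[OF of_real_hom.char_poly_hom[OF S, symmetric] as(1)] by simp
  \<comment> \<open>The embedding of the reals is injective on coefficients, so the complex
    factorization descends.\<close>
  then have "char_poly ?S = (\<Prod>r\<leftarrow>rs. [:- r, 1:])"
    by (auto simp: poly_eq_iff coeff_map_poly)
  moreover have "proots (\<Prod>r\<leftarrow>rs. [:- r, 1:]) = mset rs"
  proof (induction rs)
    case (Cons r rs)
    have "(\<Prod>r\<leftarrow>rs. [:- r, 1:]) \<noteq> 0" by (auto simp: prod_list_zero_iff)
    then show ?case using Cons by (simp add: proots_mult del: mult_pCons_left)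
  qed simp
  ultimately have \<sigma>_rs: "mset \<sigma> = mset (map sqrt rs)" using \<sigma> by simp
  show "length \<sigma> = n"
    using arg_cong[OF \<sigma>_rs, of size] as(2) by (simp add: rs_def)
  have "(\<Prod>s\<leftarrow>map of_real \<sigma>. [:- s\<^sup>2, 1 :: complex:]) = prod_mset (image_mset (\<lambda>s. [:- (of_real s)\<^sup>2, 1:]) (mset \<sigma>))"
    by (simp add: o_def flip: prod_mset_prod_list)
  also have "\<dots> = (\<Prod>r\<leftarrow>rs. [:- (of_real (sqrt r))\<^sup>2, 1:])"
    unfolding \<sigma>_rs by (simp add: o_def image_mset.compositionality flip: prod_mset_prod_list)
  also have "\<dots> = (\<Prod>a\<leftarrow>as. [:- a, 1:])"
    unfolding as_rs map_map o_def
    by (intro arg_cong[of _ _ prod_list] map_cong refl) (simp add: nonneg flip: of_real_power)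
  finally show "char_poly (?C ?S) = (\<Prod>s\<leftarrow>map of_real \<sigma>. [:- s\<^sup>2, 1:])"
    using as(1) by simp
qed

section \<open>The product formula for both orders of the part sizes\<close>

text \<open>Needed because \<open>scale_cross\<close> casts the entries before splitting, while
  \<open>partitioned_tensor\<close> splits the matrix of natural numbers.\<close>

lemma split_block_map_mat:
  assumes "split_block A r c = (A00, A01, A10, A11)" "A \<in> carrier_mat (r + r') (c + c')"
  shows "split_block (map_mat f A) r c = (map_mat f A00, map_mat f A01, map_mat f A10, map_mat f A11)"
proof -
  have "A00 = mat r c (\<lambda>ij. A $$ ij)" "A01 = mat r c' (\<lambda>(i, j). A $$ (i, j + c))"
    "A10 = mat r' c (\<lambda>(i, j). A $$ (i + r, j))" "A11 = mat r' c' (\<lambda>(i, j). A $$ (i + r, j + c))"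
    using assms by (auto simp: split_block_def Let_def)
  then show ?thesis
    using assms(2) by (simp add: split_block_def Let_def) (intro conjI eq_matI; simp)
qed

lemma prod_list_conv_prod_nth: "(\<Prod>s\<leftarrow>xs. f s) = (\<Prod>j<length xs. f (xs ! j))"
  for f :: "'b \<Rightarrow> 'a :: comm_monoid_mult"
  by (simp add: prod.list_conv_set_nth atLeast0LessThan)

theorem theorem1:
  fixes G H G00 G01 G10 G11 H00 H01 H10 H11 :: "nat mat"
    and u0 u1 v0 v1 l :: nat
    and \<sigma> :: "real list"
  assumes G: "G \<in> carrier_mat (u0 + u1) (u0 + u1)"
    and undirected: "transpose_mat G = G"
    and H: "H \<in> carrier_mat (v0 + v1) (v0 + v1)"
    and G_blocks: "split_block G u0 u0 = (G00, G01, G10, G11)"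
    and H_blocks: "split_block H v0 v0 = (H00, H01, H10, H11)"
    and l: "l = min u0 u1"
    and \<sigma>: "mset \<sigma> = singular_values (map_mat real G01)"
  shows "(u0 \<ge> u1 \<longrightarrow>
            graph_char_poly (partitioned_tensor u0 G v0 H) =
              (\<Prod>j<l. char_poly (scale_cross v0 H (complex_of_real (\<sigma> ! j)))) *
              graph_char_poly H00 ^ (u0 - u1)) \<and>
         (u1 \<ge> u0 \<longrightarrow>
            graph_char_poly (partitioned_tensor u0 G v0 H) =
              (\<Prod>j<l. char_poly (scale_cross v0 H (complex_of_real (\<sigma> ! j)))) *
              graph_char_poly H11 ^ (u1 - u0))"
proof -
  let ?c = "map_mat of_nat :: nat mat \<Rightarrow> complex mat"
  let ?r = "map_mat real"
  note Gc = split_block[OF G_blocks, of u1 u1] and Hc = split_block[OF H_blocks, of v1 v1]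
  have G_car: "G00 \<in> carrier_mat u0 u0" "G01 \<in> carrier_mat u0 u1" "G10 \<in> carrier_mat u1 u0"
    "G11 \<in> carrier_mat u1 u1" using Gc G by auto
  have "H00 \<in> carrier_mat v0 v0" "H01 \<in> carrier_mat v0 v1" "H10 \<in> carrier_mat v1 v0"
    "H11 \<in> carrier_mat v1 v1" using Hc H by auto
  note H_car = this and cH_car = this[THEN map_carrier_mat[THEN iffD2, of _ _ _ of_nat]]
  \<comment> \<open>Undirectedness of \<open>G\<close> enters here.\<close>
  have G10: "G10 = transpose_mat G01"
  proof (rule eq_matI)
    fix i j assume ij: "i < dim_row (transpose_mat G01)" "j < dim_col (transpose_mat G01)"
    then have "G10 $$ (i, j) = G $$ (i + u0, j)" "G01 $$ (j, i) = G $$ (j, i + u0)"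
      using G_blocks G G_car by (auto simp: split_block_def Let_def)
    moreover have "G $$ (i + u0, j) = G $$ (j, i + u0)"
      using arg_cong[OF undirected, of "\<lambda>M. M $$ (i + u0, j)"] G ij G_car by simp
    ultimately show "G10 $$ (i, j) = transpose_mat G01 $$ (i, j)" using ij by simp
  qed (use G_car in auto)
  have one: "?c (1\<^sub>m k) = 1\<^sub>m k" for k
    by (rule eq_matI) auto
  have tensor: "?c (partitioned_tensor u0 G v0 H) =
    four_block_mat (1\<^sub>m u0 \<otimes>\<^sub>m ?c H00) (?c G01 \<otimes>\<^sub>m ?c H01) (?c G10 \<otimes>\<^sub>m ?c H10) (1\<^sub>m u1 \<otimes>\<^sub>m ?c H11)"
    unfolding partitioned_tensor_def G_blocks H_blocks prod.case
    by (subst map_four_block_mat[of _ "u0 * v0" "u0 * v0" _ "u1 * v1" _ "u1 * v1"])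
      (use G_car H_car in \<open>auto simp: map_mat_kronecker one intro!: kronecker_carrier\<close>)
  have scale: "scale_cross v0 H s = four_block_mat (?c H00) (s \<cdot>\<^sub>m ?c H01) (s \<cdot>\<^sub>m ?c H10) (?c H11)" for s
    unfolding scale_cross_def split_block_map_mat[OF H_blocks H] prod.case ..
  let ?\<sigma> = "map complex_of_real \<sigma>"
  have real_complex: "map_mat complex_of_real (?r A * ?r B) = ?c A * ?c B"
    if "A \<in> carrier_mat m n" "B \<in> carrier_mat n m" for A B m n
    using that by (subst of_real_hom.mat_hom_mult[of _ m n _ m]) (auto intro!: arg_cong2[of _ _ _ _ "(*)"] eq_matI)
  \<comment> \<open>The strict inequality selects the branch of \<open>singular_values\<close> with
    the transpose on the left.\<close>
  have gram0: "length \<sigma> = u1 \<and> char_poly (?c G10 * ?c G01) = (\<Prod>s\<leftarrow>?\<sigma>. [:- s\<^sup>2, 1:])" if "u1 < u0"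
    using gram_char_poly[of "?r G01" u0 u1 \<sigma>] \<sigma> that G_car real_complex[OF G_car(3,2)]
    by (simp add: singular_values_def map_mat_transpose flip: G10)
  \<comment> \<open>Here \<open>singular_values\<close> uses the other product, which is the Gram
    matrix of \<open>G10\<close>.\<close>
  have gram1: "length \<sigma> = u0 \<and> char_poly (?c G01 * ?c G10) = (\<Prod>s\<leftarrow>?\<sigma>. [:- s\<^sup>2, 1:])" if "u0 \<le> u1"
    using gram_char_poly[of "?r G10" u1 u0 \<sigma>] \<sigma> that G_car real_complex[OF G_car(2,3)]
    by (simp add: singular_values_def map_mat_transpose G10)
  have prod: "(\<Prod>j<l. char_poly (scale_cross v0 H (complex_of_real (\<sigma> ! j)))) =
      (\<Prod>s\<leftarrow>?\<sigma>. char_poly (scale_cross v0 H s))"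
    using gram0 gram1 l by (cases "u0 \<le> u1") (auto simp: prod_list_conv_prod_nth o_def)
  have case0: "graph_char_poly (partitioned_tensor u0 G v0 H) =
      (\<Prod>s\<leftarrow>?\<sigma>. char_poly (scale_cross v0 H s)) * graph_char_poly H00 ^ (u0 - u1)" if "u1 < u0"
    unfolding graph_char_poly_def tensor scale
    by (rule char_poly_partitioned_tensor[OF _ _ _ _ _ cH_car]) (use gram0[OF that] that G_car in auto)
  have case1: "graph_char_poly (partitioned_tensor u0 G v0 H) =
      (\<Prod>s\<leftarrow>?\<sigma>. char_poly (scale_cross v0 H s)) * graph_char_poly H11 ^ (u1 - u0)" if "u0 \<le> u1"
  \<comment> \<open>With the two parts exchanged in both graphs, \<open>H11\<close> takes the place
    of \<open>H00\<close>, and \<open>u0\<close> becomes the smaller size.\<close>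
  proof -
    have "char_poly (?c (partitioned_tensor u0 G v0 H)) =
      char_poly (four_block_mat (1\<^sub>m u1 \<otimes>\<^sub>m ?c H11) (?c G10 \<otimes>\<^sub>m ?c H10) (?c G01 \<otimes>\<^sub>m ?c H01) (1\<^sub>m u0 \<otimes>\<^sub>m ?c H00))"
      unfolding tensor using G_car
      by (intro char_poly_four_block_swap[of _ "u0 * v0" _ "u1 * v1"] kronecker_carrier cH_car) auto
    also have "\<dots> = (\<Prod>s\<leftarrow>?\<sigma>. char_poly (four_block_mat (?c H11) (s \<cdot>\<^sub>m ?c H10) (s \<cdot>\<^sub>m ?c H01) (?c H00))) *
        char_poly (?c H11) ^ (u1 - u0)"
      by (rule char_poly_partitioned_tensor[OF _ _ _ _ _ cH_car(4,3,2,1)]) (use gram1[OF that] that G_car in auto)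
    also have "(\<lambda>s. char_poly (four_block_mat (?c H11) (s \<cdot>\<^sub>m ?c H10) (s \<cdot>\<^sub>m ?c H01) (?c H00))) =
        (\<lambda>s. char_poly (scale_cross v0 H s))"
      unfolding scale using H_car by (intro ext char_poly_four_block_swap[of _ v1 _ v0]) auto
    finally show ?thesis by (simp add: graph_char_poly_def)
  qed
  \<comment> \<open>For equal part sizes both exponents are zero, so \<open>case1\<close> yields
    both formulas.\<close>
  show ?thesis
    unfolding prod using case0 case1 by (cases "u0 = u1") auto
qed

end
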